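(* Let $\mathcal{H}_A,\mathcal{H}_B$ be finite-dimensional complex Hilbert spaces and let $\rho_A\in\mathcal{D}(\mathcal{H}_A)$, $\rho_B\in\mathcal{D}(\mathcal{H}_B)$. If $\rho\in\mathcal{C}(\rho_A,\rho_B)$ has maximal lexicographic spectrum (that is, $\mathrm{Spec}\,\sigma\le\mathrm{Spec}\,\rho$ in lexicographic order for every $\sigma\in\mathcal{C}(\rho_A,\rho_B)$), then $\rho$ is an extreme point of $\mathcal{C}(\rho_A,\rho_B)$.
   Context: $\mathcal{D}(\mathcal{H})$ is the set of density operators (states) on $\mathcal{H}$, i.e. positive semidefinite operators of trace $1$. $\mathcal{C}(\rho_A,\rho_B)=\{\rho\in\mathcal{D}(\mathcal{H}_A\otimes\mathcal{H}_B) : \mathrm{tr}_B(\rho)=\rho_A,\ \mathrm{tr}_A(\rho)=\rho_B\}$, where $\mathrm{tr}_A,\mathrm{tr}_B$ are the partial traces over $\mathcal{H}_A$ and $\mathcal{H}_B$. $\mathrm{Spec}\,\rho$ is the vector of eigenvalues of $\rho$ (with multiplicity) in decreasing order. Lexicographic order: $x$ is less than $y$ if for some index $i$, $x_j=y_j$ for all $j<i$ and $x_i<y_i$; $x\le y$ means less than or equal. *)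

theory Defs
  imports "HOL-Analysis.Analysis" "HOL-Computational_Algebra.Computational_Algebra"
begin

(* A finite-dimensional Hilbert space is represented, in a fixed orthonormal basis, as
   complex ^ 'n, and its operators as matrices. The tensor product of complex ^ 'a and
   complex ^ 'b is complex ^ ('a * 'b), the pair (i, k) indexing the product basis vector
   e_i (x) e_k. *)

(* On complex vectors the library's inner product is only the real part of the sesquilinear
   one, so the latter is written out. Since v ranges over complex vectors, membership in the
   nonnegative reals forces A to be Hermitian. *)
definition positive_semidef :: "complex ^ 'n ^ 'n \<Rightarrow> bool" where
  "positive_semidef A \<longleftrightarrow>
     (\<forall>v :: complex ^ 'n. (\<Sum>i\<in>UNIV. cnj (v $ i) * (A *v v) $ i) \<in> \<real>\<^sub>\<ge>\<^sub>0)"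

definition density_operators :: "(complex ^ 'n ^ 'n) set" where
  "density_operators = {A. positive_semidef A \<and> trace A = 1}"

definition partial_trace_A :: "complex ^ ('a::finite \<times> 'b::finite) ^ ('a \<times> 'b) \<Rightarrow> complex ^ 'b ^ 'b" where
  "partial_trace_A \<rho> = (\<chi> k l. \<Sum>i\<in>UNIV. \<rho> $ (i, k) $ (i, l))"

definition partial_trace_B :: "complex ^ ('a::finite \<times> 'b::finite) ^ ('a \<times> 'b) \<Rightarrow> complex ^ 'a ^ 'a" where
  "partial_trace_B \<rho> = (\<chi> i j. \<Sum>k\<in>UNIV. \<rho> $ (i, k) $ (j, k))"

definition couplings ::
  "complex ^ 'a ^ 'a \<Rightarrow> complex ^ 'b ^ 'b \<Rightarrow> (complex ^ ('a::finite \<times> 'b::finite) ^ ('a \<times> 'b)) set" where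
  "couplings \<rho>A \<rho>B =
     {\<rho> \<in> density_operators. partial_trace_B \<rho> = \<rho>A \<and> partial_trace_A \<rho> = \<rho>B}"

definition charpoly :: "complex ^ 'n ^ 'n \<Rightarrow> complex poly" where
  "charpoly A = det (mat [:0, 1:] - (\<chi> i j. [:A $ i $ j:]))"

(* Meant for matrices with real eigenvalues, such as density operators, where Re only
   converts the type. *)
definition Spec :: "complex ^ 'n ^ 'n \<Rightarrow> real list" where
  "Spec A = rev (sorted_list_of_multiset (image_mset Re (proots (charpoly A))))"

(* Spectra of matrices of the same size have equal length, as lex requires. *)
definition lex_le :: "real list \<Rightarrow> real list \<Rightarrow> bool" where
  "lex_le x y \<longleftrightarrow> x = y \<or> (x, y) \<in> lex {(u, v). u < v}"

end

theory Submission
  imports Defs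
begin

(* If x lies lexicographically below the decreasing list y, then the sum of exp (c * x_i) is at
   most the sum of exp (c * y_i) for all large c. So it suffices to test the convex trace
   function A |-> tr (exp (c A)). Let v be an eigenbasis of rho with eigenvalues l_i, and
   rho = (1 - t) sigma + t tau. The tangent line of exp (c -) at l_i, averaged over the spectral
   measure of sigma at v_i, bounds tr (exp (c sigma)) below by the sum of
   exp (c * l_i) * (1 + c * (<v_i, sigma v_i> - l_i)), and likewise for tau. The convex
   combination of the two bounds is tr (exp (c rho)), so maximality forces equality in both,
   and strict convexity then makes every v_i an eigenvector of sigma with eigenvalue l_i,
   that is, sigma = rho. *)

section \<open>The sesquilinear inner product\<close>

text \<open>The form written out in \<open>positive_semidef\<close>, conjugate-linear in its first
  argument.\<close>

definition cinner :: "complex ^ 'n \<Rightarrow> complex ^ 'n \<Rightarrow> complex" where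
  "cinner x y = (\<Sum>i\<in>UNIV. cnj (x $ i) * y $ i)"

lemma cinner_add_left: "cinner (x + y) z = cinner x z + cinner y z"
  by (simp add: cinner_def algebra_simps sum.distrib)

lemma cinner_add_right: "cinner z (x + y) = cinner z x + cinner z y"
  by (simp add: cinner_def algebra_simps sum.distrib)

lemma cinner_diff_right: "cinner z (x - y) = cinner z x - cinner z y"
  by (simp add: cinner_def algebra_simps sum_subtractf)

lemma cinner_smult_left: "cinner (c *s x) y = cnj c * cinner x y"
  by (simp add: cinner_def sum_distrib_left mult.assoc)

lemma cinner_smult_right: "cinner x (c *s y) = c * cinner x y"
  by (simp add: cinner_def sum_distrib_left mult.left_commute)

lemma cinner_sum_right: "cinner x (sum f I) = (\<Sum>i\<in>I. cinner x (f i))"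
  by (simp add: cinner_def sum_distrib_left sum.swap[of _ UNIV I])

lemma cnj_cinner: "cnj (cinner x y) = cinner y x"
  by (simp add: cinner_def mult.commute)

text \<open>Bridge to the real inner product, which supplies the orthogonality and dimension
  arguments below.\<close>

lemma Re_cinner: "Re (cinner x y) = inner x y"
  by (simp add: cinner_def inner_vec_def inner_complex_def)

lemma scaleR_eq_smult: "r *\<^sub>R x = complex_of_real r *s (x :: complex ^ 'n)"
  unfolding vec_eq_iff vector_scaleR_component vector_smult_component
  by (simp add: scaleR_conv_of_real)

lemma cinner_self: "cinner x x = complex_of_real ((norm x)\<^sup>2)"
proof (rule complex_eqI)
  show "Re (cinner x x) = Re (complex_of_real ((norm x)\<^sup>2))"
    by (simp add: Re_cinner power2_norm_eq_inner del: of_real_power)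
  have "Im (cinner x x) = - Im (cinner x x)"
    using cnj_cinner[of x x] by (metis cnj.sel(2))
  then show "Im (cinner x x) = Im (complex_of_real ((norm x)\<^sup>2))"
    by (simp del: of_real_power)
qed

section \<open>Hermitian matrices\<close>

definition hermitian :: "complex ^ 'n ^ 'n \<Rightarrow> bool" where
  "hermitian A \<longleftrightarrow> (\<forall>x y. cinner x (A *v y) = cinner (A *v x) y)"

text \<open>Polarization: the form is real on every vector, so expanding it at \<open>x + y\<close>
  makes the imaginary parts of the cross terms cancel; replacing \<open>y\<close> by
  \<open>\<i> *s y\<close> makes their real parts agree.\<close>

lemma positive_semidef_imp_hermitian:
  assumes "positive_semidef A"
  shows "hermitian A"
proof -
  have real: "Im (cinner v (A *v v)) = 0" for v
    using assms unfolding positive_semidef_def cinner_def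
    by (metis complex_nonneg_Reals_iff)
  have im: "Im (cinner x (A *v y)) + Im (cinner y (A *v x)) = 0" for x y
    using real[of "x + y"] real[of x] real[of y]
    by (simp add: matrix_vector_right_distrib cinner_add_left cinner_add_right)
  have re: "Re (cinner x (A *v y)) = Re (cinner y (A *v x))" for x y
    using im[of x "\<i> *s y"]
    by (simp add: vector_scalar_commute cinner_smult_left cinner_smult_right)
  have "cinner x (A *v y) = cnj (cinner y (A *v x))" for x y
    using im[of x y] re[of x y] by (simp add: complex_eq_iff)
  then show ?thesis
    by (simp add: hermitian_def cnj_cinner)
qed

text \<open>Inductive step of the spectral theorem: the quadratic form of \<open>A\<close> attains
  its maximum on the unit sphere of \<open>W\<close>, the orthogonal complement of the given
  eigenvectors. As \<open>A\<close> maps \<open>W\<close> into itself, a maximizer is an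
  eigenvector.\<close>

lemma hermitian_eigenvector_orthogonal:
  fixes A :: "complex ^ 'n ^ 'n" and v :: "'n \<Rightarrow> complex ^ 'n"
  assumes A: "hermitian A"
    and card: "card J < CARD('n)"
    and eig: "\<And>j. j \<in> J \<Longrightarrow> A *v v j = complex_of_real (d j) *s v j"
  shows "\<exists>x r. norm x = 1 \<and> A *v x = complex_of_real r *s x \<and> (\<forall>j\<in>J. cinner (v j) x = 0)"
proof -
  define W where "W = {x. \<forall>j\<in>J. cinner (v j) x = 0}"
  \<comment> \<open>Real orthogonality to both \<open>v j\<close> and \<open>\<i> *s v j\<close>
    kills the real and the imaginary part of \<open>cinner (v j) y\<close>. The real dimension of
    the whole space is twice \<open>CARD('n)\<close>, so doubling the family still leaves room for a
    nonzero \<open>y\<close>.\<close>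
  let ?S = "v ` J \<union> (\<lambda>j. \<i> *s v j) ` J"
  have "dim ?S \<le> card ?S"
    by (simp add: dim_le_card')
  also have "\<dots> \<le> card J + card J"
    by (intro order.trans[OF card_Un_le] add_mono card_image_le) auto
  also have "\<dots> < DIM(complex ^ 'n)"
    using card by simp
  finally have "dim ?S < DIM(complex ^ 'n)" .
  then obtain y where y: "y \<noteq> 0" "\<And>z. z \<in> span ?S \<Longrightarrow> orthogonal y z"
    using orthogonal_to_subspace_exists[of ?S] by metis
  have "y \<in> W"
  proof -
    have "cinner (v j) y = 0" if "j \<in> J" for j
    proof -
      have "inner (v j) y = 0" "inner (\<i> *s v j) y = 0"
        using y(2)[OF span_base] that by (auto simp: orthogonal_def inner_commute[of y])
      then show ?thesis
        by (simp add: complex_eq_iff flip: Re_cinner) (simp add: cinner_smult_left)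
    qed
    then show ?thesis by (simp add: W_def)
  qed
  have W_diff: "p - q \<in> W" if "p \<in> W" "q \<in> W" for p q
    using that by (simp add: W_def cinner_diff_right)
  have W_scale: "r *\<^sub>R p \<in> W" if "p \<in> W" for p r
    using that by (simp add: W_def scaleR_eq_smult cinner_smult_right)
  have W_A: "A *v p \<in> W" if "p \<in> W" for p
    using that A eig by (simp add: W_def hermitian_def cinner_smult_left)
  have A_scale: "A *v (r *\<^sub>R p) = r *\<^sub>R (A *v p)" for r p
    by (simp add: scaleR_eq_smult vector_scalar_commute)
  have sym: "inner p (A *v q) = inner (A *v p) q" for p q
    using A by (simp add: hermitian_def flip: Re_cinner)
  let ?K = "W \<inter> sphere 0 1"
  have "closed W"
    unfolding W_def cinner_def Ball_def
    by (intro closed_Collect_all closed_Collect_imp open_Collect_const closed_Collect_eq continuous_intros)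
  then have "compact ?K"
    by (simp add: closed_Int_compact)
  moreover have "y /\<^sub>R norm y \<in> ?K"
    using y(1) W_scale[OF \<open>y \<in> W\<close>] by simp
  moreover have "continuous_on ?K (\<lambda>x. inner x (A *v x))"
    unfolding matrix_vector_mult_def by (intro continuous_intros)
  ultimately obtain x where x: "x \<in> ?K"
    and max: "\<And>z. z \<in> ?K \<Longrightarrow> inner z (A *v z) \<le> inner x (A *v x)"
    using continuous_attains_sup[of ?K "\<lambda>x. inner x (A *v x)"] by blast
  \<comment> \<open>\<open>M\<close> is the maximum of the form; the aim is \<open>B x = 0\<close>,
    which says that \<open>x\<close> has eigenvalue \<open>M\<close>.\<close>
  define M where "M = inner x (A *v x)"
  define B where "B z = M *\<^sub>R z - A *v z" for z
  have "norm x = 1" "x \<in> W"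
    using x by auto
  have B_nonneg: "inner z (B z) \<ge> 0" if "z \<in> W" for z
  proof (cases "z = 0")
    case False
    have "z /\<^sub>R norm z \<in> ?K"
      using False W_scale[OF that] by simp
    from max[OF this] have "inner z (A *v z) / (norm z)\<^sup>2 \<le> M"
      by (simp add: A_scale M_def power2_eq_square divide_simps)
    then show ?thesis
      using False
      by (simp add: B_def inner_diff_right pos_divide_le_eq power2_norm_eq_inner)
  qed (simp add: B_def)
  have Bx0: "inner x (B x) = 0"
    using \<open>norm x = 1\<close> by (simp add: B_def inner_diff_right norm_eq_1 M_def)
  have B_sym: "inner p (B q) = inner (B p) q" for p q
    by (simp add: B_def inner_diff_right inner_diff_left sym)
  have B_diff: "B (p - r *\<^sub>R q) = B p - r *\<^sub>R B q" for p q r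
    by (simp add: B_def A_scale matrix_vector_mult_diff_distrib algebra_simps)
  define h where "h = B x"
  have "h \<in> W"
    unfolding h_def B_def by (intro W_diff W_scale W_A \<open>x \<in> W\<close>)
  \<comment> \<open>The form of \<open>B\<close> is nonnegative on \<open>W\<close> and vanishes at \<open>x\<close>, so its derivative there in direction \<open>h = B x\<close> vanishes.\<close>
  have quad: "0 \<le> s\<^sup>2 * inner h (B h) - 2 * s * inner h h" for s
  proof -
    have "0 \<le> inner (x - s *\<^sub>R h) (B (x - s *\<^sub>R h))"
      by (intro B_nonneg W_diff W_scale \<open>x \<in> W\<close> \<open>h \<in> W\<close>)
    also have "\<dots> = inner x (B x) - s * inner x (B h) - s * inner h (B x) + s\<^sup>2 * inner h (B h)"
      by (simp add: B_diff inner_diff_left inner_diff_right algebra_simps power2_eq_square)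
    also have "\<dots> = s\<^sup>2 * inner h (B h) - 2 * s * inner h h"
      by (simp add: Bx0 B_sym[of x h]) (simp add: h_def)
    finally show ?thesis .
  qed
  have "inner h h = 0"
  proof (rule ccontr)
    assume "inner h h \<noteq> 0"
    define p where "p = inner h h"
    define q where "q = inner h (B h)"
    have "p > 0" "q \<ge> 0"
      using \<open>inner h h \<noteq> 0\<close> B_nonneg[OF \<open>h \<in> W\<close>] by (auto simp: p_def q_def)
    \<comment> \<open>The quadratic in \<open>s\<close> is minimal at \<open>p / q\<close> if
      \<open>q > 0\<close>; the \<open>+ 1\<close> avoids division by zero and still gives a
      negative value.\<close>
    have "(p / (q + 1))\<^sup>2 * q - 2 * (p / (q + 1)) * p = - (p / (q + 1))\<^sup>2 * (q + 2)"
      using \<open>q \<ge> 0\<close> by (simp add: field_simps power2_eq_square add_nonneg_eq_0_iff)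
    also have "\<dots> < 0"
      using \<open>p > 0\<close> \<open>q \<ge> 0\<close> by simp
    finally show False
      using quad[of "p / (q + 1)"] by (simp add: p_def q_def)
  qed
  then have "A *v x = complex_of_real M *s x"
    by (simp add: h_def B_def scaleR_eq_smult)
  then show ?thesis
    using \<open>norm x = 1\<close> \<open>x \<in> W\<close> by (auto simp: W_def)
qed

text \<open>Vectors are indexed by the coordinate type, so their number is the dimension and
  completeness follows from orthonormality. The eigenvalues \<open>d\<close> are unordered.\<close>

definition eigenbasis :: "complex ^ 'n ^ 'n \<Rightarrow> ('n \<Rightarrow> complex ^ 'n) \<Rightarrow> ('n \<Rightarrow> real) \<Rightarrow> bool" where
  "eigenbasis A v d \<longleftrightarrow>
     (\<forall>i j. cinner (v i) (v j) = (if i = j then 1 else 0)) \<and>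
     (\<forall>i. A *v v i = complex_of_real (d i) *s v i)"

theorem hermitian_imp_eigenbasis:
  fixes A :: "complex ^ 'n ^ 'n"
  assumes "hermitian A"
  shows "\<exists>v d. eigenbasis A v d"
proof -
  \<comment> \<open>Induction on the set of indices already filled; values outside \<open>J\<close>
    are arbitrary.\<close>
  have "\<exists>v d. (\<forall>i\<in>J. \<forall>j\<in>J. cinner (v i) (v j) = (if i = j then 1 else 0)) \<and>
          (\<forall>i\<in>J. A *v v i = complex_of_real (d i) *s v i)" for J :: "'n set"
    using finite[of J]
  proof (induction J)
    case (insert k J)
    then obtain v d where v: "\<And>i j. i \<in> J \<Longrightarrow> j \<in> J \<Longrightarrow> cinner (v i) (v j) = (if i = j then 1 else 0)"
      and d: "\<And>i. i \<in> J \<Longrightarrow> A *v v i = complex_of_real (d i) *s v i"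
      by blast
    have "card J < CARD('n)"
      using insert.hyps by (metis finite UNIV_I psubsetI psubset_card_mono subset_UNIV)
    then obtain x r where x: "norm x = 1" "A *v x = complex_of_real r *s x"
        "\<And>j. j \<in> J \<Longrightarrow> cinner (v j) x = 0"
      using hermitian_eigenvector_orthogonal[OF assms, of J v d] d by blast
    have xx: "cinner x x = 1"
      using x(1) by (simp add: cinner_self)
    have x': "cinner x (v j) = 0" if "j \<in> J" for j
      using x(3)[OF that] cnj_cinner[of "v j" x] by simp
    show ?case
      using insert.hyps v d x(2,3) xx x'
      by (intro exI[of _ "v(k := x)"] exI[of _ "d(k := r)"]) auto
  qed auto
  from this[of UNIV] show ?thesis
    by (simp add: eigenbasis_def)
qed

section \<open>Coordinates and quadratic forms in an eigenbasis\<close>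

lemma eigenbasis_expansion:
  fixes A :: "complex ^ 'n ^ 'n"
  assumes "eigenbasis A v d"
  shows "x = (\<Sum>j\<in>UNIV. cinner (v j) x *s v j)"
proof -
  define U where "U = (\<chi> i j. v j $ i)"
  define V where "V = (\<chi> i j. cnj (v i $ j))"
  have "V ** U = mat 1"
    using assms
    by (simp add: eigenbasis_def U_def V_def matrix_matrix_mult_def mat_def vec_eq_iff cinner_def)
  \<comment> \<open>A one-sided inverse of a square matrix is two-sided: orthonormality becomes
    completeness.\<close>
  then have "U ** V = mat 1"
    by (rule matrix_left_right_inverse1)
  then have "x = U *v (V *v x)"
    by (simp add: matrix_vector_mul_assoc)
  also have "\<dots> = (\<Sum>j\<in>UNIV. cinner (v j) x *s v j)"
    by (simp add: U_def V_def vec_eq_iff matrix_vector_mult_def cinner_def mult.commute)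
  finally show ?thesis .
qed

lemma matrix_vector_right_sum: "A *v (sum f I) = (\<Sum>i\<in>I. A *v f i)"
  by (induction I rule: infinite_finite_induct) (simp_all add: matrix_vector_right_distrib)

lemma eigenbasis_unique_matrix:
  assumes A: "eigenbasis A v d" and B: "\<And>i. B *v v i = complex_of_real (d i) *s v i"
  shows "A = B"
proof -
  have "A *v x = B *v x" for x
  proof -
    have "C *v x = (\<Sum>j\<in>UNIV. cinner (v j) x *s (C *v v j))" for C :: "complex ^ 'a ^ 'a"
      by (subst eigenbasis_expansion[OF A, of x])
        (simp add: matrix_vector_right_sum vector_scalar_commute)
    then show ?thesis
      using A B by (simp add: eigenbasis_def)
  qed
  then show ?thesis
    by (simp add: matrix_eq)
qed

lemma eigenbasis_parseval:
  assumes "eigenbasis A v d"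
  shows "(\<Sum>j\<in>UNIV. (cmod (cinner (v j) x))\<^sup>2) = (norm x)\<^sup>2"
proof -
  have "complex_of_real ((norm x)\<^sup>2) = cinner x (\<Sum>j\<in>UNIV. cinner (v j) x *s v j)"
    using eigenbasis_expansion[OF assms, of x] cinner_self[of x] by simp
  also have "\<dots> = (\<Sum>j\<in>UNIV. cinner (v j) x * cnj (cinner (v j) x))"
    by (simp add: cinner_sum_right cinner_smult_right cnj_cinner)
  also have "\<dots> = complex_of_real (\<Sum>j\<in>UNIV. (cmod (cinner (v j) x))\<^sup>2)"
    by (simp add: complex_norm_square del: of_real_power)
  finally show ?thesis
    using of_real_eq_iff by metis
qed

lemma eigenbasis_apply:
  assumes "eigenbasis A v d"
  shows "A *v x = (\<Sum>j\<in>UNIV. (cinner (v j) x * complex_of_real (d j)) *s v j)"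
  using assms
  by (subst eigenbasis_expansion[OF assms, of x])
    (simp add: eigenbasis_def matrix_vector_right_sum vector_scalar_commute vector_smult_assoc)

text \<open>The squared moduli are the weights of the spectral measure of \<open>A\<close> at
  \<open>x\<close>: \<open>eigenbasis_parseval\<close> gives its mass, this its first
  moment.\<close>

lemma eigenbasis_quadratic_form:
  assumes "eigenbasis A v d"
  shows "inner x (A *v x) = (\<Sum>j\<in>UNIV. (cmod (cinner (v j) x))\<^sup>2 * d j)"
proof -
  have "cinner x (A *v x) = (\<Sum>j\<in>UNIV. cinner (v j) x * cnj (cinner (v j) x) * complex_of_real (d j))"
    by (simp add: eigenbasis_apply[OF assms, of x] cinner_sum_right cinner_smult_right cnj_cinner mult_ac)
  also have "\<dots> = complex_of_real (\<Sum>j\<in>UNIV. (cmod (cinner (v j) x))\<^sup>2 * d j)"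
    by (simp add: complex_norm_square del: of_real_power)
  finally show ?thesis
    by (metis Re_cinner Re_complex_of_real)
qed

section \<open>Spectra\<close>

text \<open>Evaluation is a ring homomorphism, so characteristic polynomials can be compared
  pointwise, over a field where nonzero determinants cancel.\<close>

lemma poly_det: "poly (det M) x = det (\<chi> i j. poly (M $ i $ j) x)"
  for M :: "'a::comm_ring_1 poly ^ 'n ^ 'n"
  by (simp add: det_def poly_sum poly_prod)

lemma charpoly_eigenbasis:
  fixes A :: "complex ^ 'n ^ 'n"
  assumes "eigenbasis A v d"
  shows "charpoly A = (\<Prod>i\<in>UNIV. [:- complex_of_real (d i), 1:])"
proof (rule poly_eq_poly_eq_iff[THEN iffD1], rule ext)
  show "poly (charpoly A) x = poly (\<Prod>i\<in>UNIV. [:- complex_of_real (d i), 1:]) x" for x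
  proof -
    define U where "U = (\<chi> i j. v j $ i)"
    define V where "V = (\<chi> i j. cnj (v i $ j))"
    define D :: "complex ^ 'n ^ 'n" where "D = (\<chi> i j. if i = j then x - complex_of_real (d i) else 0)"
    have VU: "V ** U = mat 1"
      using assms
      by (simp add: eigenbasis_def U_def V_def matrix_matrix_mult_def mat_def vec_eq_iff cinner_def)
    have "det V * det U = 1"
      using VU by (metis det_I det_mul)
    then have "det U \<noteq> 0" by auto
    have ev: "(\<Sum>k\<in>UNIV. v j $ k * A $ i $ k) = complex_of_real (d j) * v j $ i" for i j
      using assms by (simp add: eigenbasis_def vec_eq_iff matrix_vector_mult_def mult.commute)
    \<comment> \<open>Column \<open>j\<close> of either side is \<open>x - d j\<close> times the
      eigenvector \<open>v j\<close>.\<close>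
    have "(mat x - A) ** U = U ** D"
      by (simp add: vec_eq_iff matrix_matrix_mult_def U_def D_def mat_def
          left_diff_distrib right_diff_distrib sum_subtractf ev if_distrib[of "\<lambda>z. z * _"]
          if_distrib[of "\<lambda>z. _ * z"] mult.commute cong: if_cong)
    then have "det (mat x - A) * det U = det U * det D"
      by (metis det_mul)
    then have "det (mat x - A) = det D"
      using \<open>det U \<noteq> 0\<close> by simp
    also have "\<dots> = (\<Prod>i\<in>UNIV. x - complex_of_real (d i))"
      by (subst det_diagonal) (simp_all add: D_def)
    also have "det (mat x - A) = poly (charpoly A) x"
      by (simp add: charpoly_def poly_det) (auto intro!: arg_cong[where f = det] simp: vec_eq_iff mat_def)
    finally show ?thesis
      by (simp add: poly_prod)
  qed
qed

lemma Spec_eigenbasis: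
  fixes A :: "complex ^ 'n ^ 'n"
  assumes "eigenbasis A v d"
  shows "Spec A = rev (sorted_list_of_multiset (image_mset d (mset_set UNIV)))"
proof -
  have "proots (charpoly A) = (\<Sum>i\<in>UNIV. {#complex_of_real (d i)#})"
    by (simp add: charpoly_eigenbasis[OF assms] proots_prod)
  also have "\<dots> = image_mset (\<lambda>i. complex_of_real (d i)) (mset_set UNIV)"
    by (simp add: sum_unfold_sum_mset)
  finally show ?thesis
    by (simp add: Spec_def multiset.map_comp comp_def)
qed

text \<open>A sum over the spectrum ignores the sorting, so traces of functions of \<open>A\<close>
  can be computed in any eigenbasis.\<close>

lemma sum_list_Spec_eigenbasis:
  fixes f :: "real \<Rightarrow> real"
  assumes "eigenbasis A v d"
  shows "(\<Sum>x\<leftarrow>Spec A. f x) = (\<Sum>i\<in>UNIV. f (d i))"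
proof -
  have "(\<Sum>x\<leftarrow>Spec A. f x) = sum_mset (image_mset f (mset (Spec A)))"
    by (metis mset_map sum_mset_sum_list)
  also have "\<dots> = (\<Sum>i\<in>UNIV. f (d i))"
    by (simp add: Spec_eigenbasis[OF assms] multiset.map_comp comp_def sum_unfold_sum_mset)
  finally show ?thesis .
qed

text \<open>Let \<open>a < b\<close> be the first differing entries. As \<open>x\<close> is
  decreasing, all its later entries are at most \<open>a\<close>, so for large \<open>c\<close> the
  single term \<open>exp (c * b)\<close> outweighs the rest of \<open>x\<close>.\<close>

lemma eventually_sum_exp_le_of_lex_le:
  assumes "lex_le x y" "sorted (rev x)"
  shows "\<forall>\<^sub>F c in at_top. (\<Sum>a\<leftarrow>x. exp (c * a)) \<le> (\<Sum>a\<leftarrow>y. exp (c * a))"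
proof (cases "x = y")
  case False
  then obtain p a b xs ys where x: "x = p @ a # xs" and y: "y = p @ b # ys" and "a < b"
    using assms(1) by (simp add: lex_le_def lex_conv) blast
  have le: "z \<le> a" if "z \<in> set xs" for z
    using assms(2) that by (auto simp: x sorted_append)
  have bound: "(\<Sum>a\<leftarrow>x. exp (c * a)) \<le> (\<Sum>a\<leftarrow>y. exp (c * a))"
    \<comment> \<open>At the threshold \<open>exp (c * (b - a))\<close> equals the number of entries
      of \<open>x\<close> from \<open>a\<close> on, \<open>a\<close> included.\<close>
    if c: "c \<ge> 0" "ln (real (length xs + 1)) / (b - a) \<le> c" for c
  proof -
    have "(\<Sum>z\<leftarrow>xs. exp (c * z)) \<le> (\<Sum>z\<leftarrow>xs. exp (c * a))"
      using le c by (intro sum_list_mono) (auto intro: mult_left_mono)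
    then have "exp (c * a) + (\<Sum>z\<leftarrow>xs. exp (c * z)) \<le> real (length xs + 1) * exp (c * a)"
      by (simp add: sum_list_triv algebra_simps)
    also have "ln (real (length xs + 1)) \<le> c * (b - a)"
      using c \<open>a < b\<close> by (simp add: pos_divide_le_eq)
    then have "real (length xs + 1) \<le> exp (c * (b - a))"
      by (metis exp_le_cancel_iff exp_ln of_nat_0_less_iff zero_less_Suc Suc_eq_plus1)
    then have "real (length xs + 1) * exp (c * a) \<le> exp (c * (b - a)) * exp (c * a)"
      by (intro mult_right_mono) auto
    also have "\<dots> = exp (c * b)"
      by (simp add: algebra_simps flip: exp_add)
    also have "\<dots> \<le> exp (c * b) + (\<Sum>z\<leftarrow>ys. exp (c * z))"
      using sum_list_nonneg[of "map (\<lambda>z. exp (c * z)) ys"] by force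
    finally show ?thesis
      by (simp add: x y)
  qed
  show ?thesis
    using eventually_ge_at_top[of 0] eventually_ge_at_top[of "ln (real (length xs + 1)) / (b - a)"]
    by eventually_elim (rule bound)
qed simp

section \<open>Strict convexity of the trace of the exponential\<close>

lemma exp_tangent_le: "exp (c * l) * (1 + c * (s - l)) \<le> exp (c * s)" for c l s :: real
proof -
  have "exp (c * l) * (1 + c * (s - l)) \<le> exp (c * l) * exp (c * (s - l))"
    by (intro mult_left_mono) auto
  then show ?thesis
    by (simp add: algebra_simps flip: exp_add)
qed

lemma exp_tangent_eq:
  fixes c l s :: real
  assumes "exp (c * s) = exp (c * l) * (1 + c * (s - l))" "c \<noteq> 0"
  shows "s = l"
proof -
  have "exp (c * l) * exp (c * (s - l)) = exp (c * l) * (1 + c * (s - l))"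
    using assms(1) by (simp add: algebra_simps flip: exp_add)
  then have "exp (c * (s - l)) = 1 + c * (s - l)"
    by (metis exp_not_eq_zero mult_left_cancel)
  \<comment> \<open>With \<open>y = exp (c * (s - l))\<close>, equality reads
    \<open>ln y = y - 1\<close>, which holds only at \<open>y = 1\<close>.\<close>
  then have "ln (exp (c * (s - l))) = exp (c * (s - l)) - 1"
    by (subst ln_exp) simp
  then have "exp (c * (s - l)) = 1"
    by (intro ln_eq_minus_one) auto
  then show ?thesis
    using assms(2) by simp
qed

lemma sum_exp_tangent:
  fixes A B :: "complex ^ 'n ^ 'n"
  assumes A: "eigenbasis A v l" and B: "eigenbasis B w s"
  defines "T \<equiv> \<lambda>c. \<Sum>i\<in>UNIV. exp (c * l i) * (1 + c * (inner (v i) (B *v v i) - l i))"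
  shows "T c \<le> (\<Sum>j\<in>UNIV. exp (c * s j))"
    and "T c = (\<Sum>j\<in>UNIV. exp (c * s j)) \<Longrightarrow> c \<noteq> 0 \<Longrightarrow> A = B"
proof -
  \<comment> \<open>\<open>P\<close> is doubly stochastic. Averaging the tangent bounds with these
    weights, the row sums \<open>P1\<close> produce \<open>T c\<close> and the column sums
    \<open>P2\<close> the trace of the exponential of \<open>cB\<close>, so the gap is a sum of
    nonnegative terms \<open>P i j * g i j\<close>.\<close>
  define P where "P i j = (cmod (cinner (w j) (v i)))\<^sup>2" for i j
  define g where "g i j = exp (c * s j) - exp (c * l i) * (1 + c * (s j - l i))" for i j
  have norm1: "norm (u i) = 1" if "eigenbasis C u e" for C :: "complex ^ 'n ^ 'n" and u e i
  proof -
    have "complex_of_real ((norm (u i))\<^sup>2) = 1"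
      using that cinner_self[of "u i"] by (simp add: eigenbasis_def)
    then have "(norm (u i))\<^sup>2 = 1"
      using of_real_eq_1_iff by blast
    then show ?thesis
      by (simp add: power2_eq_1_iff) (smt (verit) norm_ge_zero)
  qed
  have P1: "(\<Sum>j\<in>UNIV. P i j) = 1" for i
    using eigenbasis_parseval[OF B, of "v i"] norm1[OF A] by (simp add: P_def)
  have P2: "(\<Sum>i\<in>UNIV. P i j) = 1" for j
  proof -
    have "cmod (cinner (w j) (v i)) = cmod (cinner (v i) (w j))" for i
      by (metis cnj_cinner complex_mod_cnj)
    then show ?thesis
      using eigenbasis_parseval[OF A, of "w j"] norm1[OF B] by (simp add: P_def)
  qed
  have Pg: "P i j * g i j \<ge> 0" for i j
    using exp_tangent_le by (simp add: P_def g_def)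
  have "(\<Sum>j\<in>UNIV. P i j * (exp (c * l i) * (1 + c * (s j - l i))))
      = exp (c * l i) * (1 + c * (inner (v i) (B *v v i) - l i))" for i
  proof -
    have "(\<Sum>j\<in>UNIV. P i j * (exp (c * l i) * (1 + c * (s j - l i))))
      = exp (c * l i) * ((1 - c * l i) * (\<Sum>j\<in>UNIV. P i j) + c * (\<Sum>j\<in>UNIV. P i j * s j))"
      unfolding sum_distrib_left sum.distrib[symmetric] by (intro sum.cong refl) algebra
    also have "\<dots> = exp (c * l i) * (1 + c * (inner (v i) (B *v v i) - l i))"
      unfolding P1 by (simp add: eigenbasis_quadratic_form[OF B] P_def algebra_simps)
    finally show ?thesis .
  qed
  moreover have "(\<Sum>i\<in>UNIV. \<Sum>j\<in>UNIV. P i j * exp (c * s j)) = (\<Sum>j\<in>UNIV. exp (c * s j))"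
    by (subst sum.swap) (simp add: P2 flip: sum_distrib_right)
  ultimately have diff: "(\<Sum>j\<in>UNIV. exp (c * s j)) - T c = (\<Sum>i\<in>UNIV. \<Sum>j\<in>UNIV. P i j * g i j)"
    by (simp add: T_def g_def right_diff_distrib sum_subtractf)
  have "(\<Sum>i\<in>UNIV. \<Sum>j\<in>UNIV. P i j * g i j) \<ge> 0"
    by (intro sum_nonneg Pg)
  with diff show "T c \<le> (\<Sum>j\<in>UNIV. exp (c * s j))"
    by simp
  assume eq: "T c = (\<Sum>j\<in>UNIV. exp (c * s j))" and "c \<noteq> 0"
  have "\<forall>i\<in>UNIV. (\<Sum>j\<in>UNIV. P i j * g i j) = 0"
    using diff eq by (subst sum_nonneg_eq_0_iff[symmetric]) (auto intro: sum_nonneg Pg)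
  then have "P i j * g i j = 0" for i j
    using sum_nonneg_eq_0_iff[of UNIV "\<lambda>j. P i j * g i j"] Pg by auto
  \<comment> \<open>Strict convexity: \<open>v i\<close> has components only along those
    \<open>w j\<close> with eigenvalue \<open>l i\<close>, hence is itself an eigenvector of
    \<open>B\<close> for \<open>l i\<close>.\<close>
  then have "cinner (w j) (v i) = 0 \<or> s j = l i" for i j
    using exp_tangent_eq[of c "s j" "l i"] \<open>c \<noteq> 0\<close> by (fastforce simp: P_def g_def)
  then have "cinner (w j) (v i) * complex_of_real (s j) = complex_of_real (l i) * cinner (w j) (v i)" for i j
    by (metis mult.commute mult_zero_left)
  then have "B *v v i = (\<Sum>j\<in>UNIV. (complex_of_real (l i) * cinner (w j) (v i)) *s w j)" for i
    by (simp only: eigenbasis_apply[OF B])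
  also have "\<dots> i = complex_of_real (l i) *s (\<Sum>j\<in>UNIV. cinner (w j) (v i) *s w j)" for i
    by (simp add: vec_eq_iff sum_distrib_left mult.assoc)
  also have "\<dots> i = complex_of_real (l i) *s v i" for i
    using eigenbasis_expansion[OF B, of "v i"] by simp
  finally show "A = B"
    by (intro eigenbasis_unique_matrix[OF A])
qed

text \<open>The argument compares \<open>R\<close> only with the endpoints of a segment through it,
  so \<open>S\<close> may be any set of Hermitian matrices.\<close>

theorem max_lex_Spec_imp_extreme_point:
  fixes S :: "(complex ^ 'n ^ 'n) set"
  assumes herm: "\<And>A. A \<in> S \<Longrightarrow> hermitian A"
    and "R \<in> S"
    and max: "\<And>A. A \<in> S \<Longrightarrow> lex_le (Spec A) (Spec R)"
  shows "R extreme_point_of S"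
  unfolding extreme_point_of_def
proof (intro conjI ballI notI)
  fix A B assume "A \<in> S" "B \<in> S" and seg: "R \<in> open_segment A B"
  obtain t where t: "0 < t" "t < 1" and R: "R = (1 - t) *\<^sub>R A + t *\<^sub>R B"
    using seg by (auto simp: in_segment)
  obtain v l where v: "eigenbasis R v l"
    using hermitian_imp_eigenbasis[OF herm[OF \<open>R \<in> S\<close>]] by blast
  obtain wA sA where wA: "eigenbasis A wA sA"
    using hermitian_imp_eigenbasis[OF herm[OF \<open>A \<in> S\<close>]] by blast
  obtain wB sB where wB: "eigenbasis B wB sB"
    using hermitian_imp_eigenbasis[OF herm[OF \<open>B \<in> S\<close>]] by blast
  \<comment> \<open>\<open>Spec\<close> is decreasing by construction, which supplies the sortedness
    that the comparison of exponential sums asks for.\<close>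
  have dom: "\<forall>\<^sub>F c in at_top. (\<Sum>j\<in>UNIV. exp (c * s j)) \<le> (\<Sum>i\<in>UNIV. exp (c * l i))"
    if "C \<in> S" and C: "eigenbasis C w s" for C w s
    using eventually_sum_exp_le_of_lex_le[OF max[OF \<open>C \<in> S\<close>]]
    by (simp add: sum_list_Spec_eigenbasis[OF C] sum_list_Spec_eigenbasis[OF v])
      (simp add: Spec_eigenbasis[OF C])
  have "\<forall>\<^sub>F c :: real in at_top. c > 0 \<and> (\<Sum>j\<in>UNIV. exp (c * sA j)) \<le> (\<Sum>i\<in>UNIV. exp (c * l i))
      \<and> (\<Sum>j\<in>UNIV. exp (c * sB j)) \<le> (\<Sum>i\<in>UNIV. exp (c * l i))"
    by (intro eventually_conj eventually_gt_at_top dom[OF \<open>A \<in> S\<close> wA] dom[OF \<open>B \<in> S\<close> wB])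
  then obtain c :: real where "c > 0"
    and cA: "(\<Sum>j\<in>UNIV. exp (c * sA j)) \<le> (\<Sum>i\<in>UNIV. exp (c * l i))"
    and cB: "(\<Sum>j\<in>UNIV. exp (c * sB j)) \<le> (\<Sum>i\<in>UNIV. exp (c * l i))"
    by (metis (no_types, lifting) eventually_at_top_linorder order_refl)
  define T where "T C = (\<Sum>i\<in>UNIV. exp (c * l i) * (1 + c * (inner (v i) (C *v v i) - l i)))" for C
  have TA: "T A \<le> (\<Sum>j\<in>UNIV. exp (c * sA j))" and TB: "T B \<le> (\<Sum>j\<in>UNIV. exp (c * sB j))"
    unfolding T_def by (intro sum_exp_tangent(1)[OF v wA] sum_exp_tangent(1)[OF v wB])+
  have "R *v x = (1 - t) *\<^sub>R (A *v x) + t *\<^sub>R (B *v x)" for x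
    unfolding R
    by (simp add: vec_eq_iff matrix_vector_mult_def scaleR_sum_right distrib_right sum.distrib)
  then have lin: "inner (v i) (R *v v i) = (1 - t) * inner (v i) (A *v v i) + t * inner (v i) (B *v v i)" for i
    by (simp add: inner_add_right)
  \<comment> \<open>With \<open>c\<close> and the eigenbasis of \<open>R\<close> fixed,
    \<open>T\<close> is affine in its argument.\<close>
  have "T R = (1 - t) * T A + t * T B"
    unfolding T_def sum_distrib_left sum.distrib[symmetric]
    by (intro sum.cong refl) (unfold lin, algebra)
  moreover have TR: "T R = (\<Sum>i\<in>UNIV. exp (c * l i))"
  proof -
    have "inner (v i) (R *v v i) = l i" for i
      using v cinner_smult_right[of "v i" "complex_of_real (l i)" "v i"]
      by (simp add: eigenbasis_def flip: Re_cinner)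
    then show ?thesis
      by (simp add: T_def)
  qed
  \<comment> \<open>By affinity these two nonnegative terms add up to zero, so both vanish.\<close>
  moreover have "(1 - t) * (T R - T A) \<ge> 0" "t * (T R - T B) \<ge> 0"
    using t TA TB cA cB TR by simp_all
  ultimately have "(1 - t) * (T R - T A) = 0"
    by (simp add: algebra_simps)
  then have "T A = T R"
    using t by simp
  then have "T A = (\<Sum>j\<in>UNIV. exp (c * sA j))"
    using TA cA TR by simp
  then have "R = A"
    using \<open>c > 0\<close> sum_exp_tangent(2)[OF v wA, of c] by (simp add: T_def)
  \<comment> \<open>An open segment excludes its endpoints.\<close>
  then show False
    using seg by (simp add: open_segment_def)
qed (fact \<open>R \<in> S\<close>)

theorem corollary3p11:
  fixes \<rho>A :: "complex ^ 'a ^ 'a"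
    and \<rho>B :: "complex ^ 'b ^ 'b"
    and \<rho> :: "complex ^ ('a::finite \<times> 'b::finite) ^ ('a \<times> 'b)"
  assumes "\<rho>A \<in> density_operators"
    and "\<rho>B \<in> density_operators"
    and "\<rho> \<in> couplings \<rho>A \<rho>B"
    and "\<And>\<sigma>. \<sigma> \<in> couplings \<rho>A \<rho>B \<Longrightarrow> lex_le (Spec \<sigma>) (Spec \<rho>)"
  shows "\<rho> extreme_point_of couplings \<rho>A \<rho>B"
  \<comment> \<open>Couplings are positive semidefinite, hence Hermitian.\<close>
  using assms(3,4)
  by (intro max_lex_Spec_imp_extreme_point positive_semidef_imp_hermitian)
    (auto simp: couplings_def density_operators_def)

end
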